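(* Assume that the equation $x'=A_3(t)x^{n_3}+A_2(t)x^{n_2}+A_1(t)x^{n_1}$ has at least three distinct nonconstant rational solutions. Then the set of degrees of the denominators of all nonconstant rational solutions, that is, $\{\deg p: x(t)=1/p(t)\text{ is a nonconstant rational solution}\}$, has cardinality at most $3$.
   Context: $\Bbbk\in\{\mathbb{R},\mathbb{C}\}$; $n_1,n_2,n_3$ are natural numbers with $1<n_1<n_2<n_3$; $A_1,A_2,A_3\in\Bbbk[t]$ are nonzero polynomials. Rational solutions are elements of $\Bbbk(t)$ satisfying the equation identically; every nonconstant rational solution has the form $x=1/p(t)$ with $p\in\Bbbk[t]$, $\deg p\ge1$, and $p$ is its denominator. *)

theory Defs
  imports Complex_Main "HOL-Computational_Algebra.Computational_Algebra"
begin

text \<open>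
  The field of rational functions \<open>k(t)\<close> is \<open>'a poly fract\<close>.  The library has no derivation on it,
  so the formal derivative \<open>d/dt\<close> is defined here by the quotient rule; the lemma
  \<open>rat_deriv_Fract\<close> shows that the value does not depend on the chosen fraction.
\<close>

definition rat_deriv :: "'a::field poly fract \<Rightarrow> 'a poly fract" where
  "rat_deriv x = (THE y. \<exists>a b. b \<noteq> 0 \<and> x = Fraction_Field.Fract a b \<and>
      y = Fraction_Field.Fract (pderiv a * b - a * pderiv b) (b ^ 2))"

lemma rat_deriv_Fract:
  fixes a b :: "'a::field poly"
  assumes b: "b \<noteq> 0"
  shows "rat_deriv (Fraction_Field.Fract a b)
     = Fraction_Field.Fract (pderiv a * b - a * pderiv b) (b ^ 2)"
proof -
  have wd: "Fraction_Field.Fract (pderiv c * d - c * pderiv d) (d ^ 2)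
      = Fraction_Field.Fract (pderiv a * b - a * pderiv b) (b ^ 2)"
    if "d \<noteq> 0" "Fraction_Field.Fract a b = Fraction_Field.Fract c d" for c d
  proof -
    have eq: "a * d = c * b" using that b by (simp add: eq_fract)
    hence "pderiv (a * d) = pderiv (c * b)" by simp
    hence d: "pderiv a * d = c * pderiv b + b * pderiv c - a * pderiv d"
      by (simp add: pderiv_mult algebra_simps)
    have "(pderiv a * b - a * pderiv b) * d\<^sup>2
        = (pderiv a * d) * (b * d) - (a * d) * (pderiv b * d)"
      by (simp add: power2_eq_square algebra_simps)
    also have "\<dots> = b * pderiv c * (b * d) - (a * d) * (b * pderiv d)"
      using d eq by algebra
    also have "\<dots> = (pderiv c * d - c * pderiv d) * b\<^sup>2"
      unfolding eq by (simp add: power2_eq_square algebra_simps)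
    finally show ?thesis using that b by (simp add: eq_fract)
  qed
  show ?thesis
    unfolding rat_deriv_def by (rule the_equality) (use b wd in blast)+
qed

definition nonconst_rat_solutions ::
  "nat \<Rightarrow> nat \<Rightarrow> nat \<Rightarrow> 'a::field poly \<Rightarrow> 'a poly \<Rightarrow> 'a poly \<Rightarrow> 'a poly fract set" where
  "nonconst_rat_solutions n1 n2 n3 A1 A2 A3 =
     {x. rat_deriv x = to_fract A3 * x ^ n3 + to_fract A2 * x ^ n2 + to_fract A1 * x ^ n1
         \<and> (\<forall>c. x \<noteq> to_fract [:c:])}"

text \<open>
  A polynomial \<open>p\<close> counts as a denominator of \<open>S\<close> if \<open>1 / p \<in> S\<close>.  The zero polynomial is harmless:
  \<open>1 / 0 = 0\<close> is a constant, hence never in the set of nonconstant solutions.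
\<close>

definition denominator_degrees :: "'a::field poly fract set \<Rightarrow> nat set" where
  "denominator_degrees S = {degree p | p. 1 / to_fract p \<in> S}"

end

theory Submission
  imports Defs
begin

text \<open>
  Substituting \<open>x = 1 / p\<close> and clearing denominators turns the equation into a vanishing sum of
  nonzero polynomials whose degrees are affine functions of \<open>degree p\<close> with pairwise different
  slopes. In such a sum the maximal degree is attained twice, so \<open>degree p\<close> is a breakpoint of the
  upper envelope of these affine functions, and an envelope of \<open>m\<close> lines has at most \<open>m - 1\<close>
  breakpoints.
\<close>

text \<open>Sending each breakpoint to the steeper of two lines that tie for the maximum there is
  injective and misses the line of least slope.\<close>

lemma card_envelope_breakpoints:
  fixes c s :: "'i \<Rightarrow> int" and D :: "int set"
  assumes fin: "finite I" and ne: "I \<noteq> {}" and inj: "inj_on s I"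
    and D: "\<And>d. d \<in> D \<Longrightarrow> \<exists>i\<in>I. \<exists>j\<in>I. i \<noteq> j \<and> c i + s i * d = c j + s j * d
              \<and> (\<forall>k\<in>I. c k + s k * d \<le> c i + s i * d)"
  shows "finite D \<and> card D \<le> card I - 1"
proof -
  \<comment> \<open>Slopes are distinct and a tie is symmetric, so \<open>i\<close> can be taken as
    the steeper line.\<close>
  have "\<exists>i\<in>I. \<exists>j\<in>I. s j < s i \<and> c i + s i * d = c j + s j * d
          \<and> (\<forall>k\<in>I. c k + s k * d \<le> c i + s i * d)" if d: "d \<in> D" for d
  proof -
    from D[OF d] obtain i j where ij: "i \<in> I" "j \<in> I" "i \<noteq> j"
      "c i + s i * d = c j + s j * d" "\<forall>k\<in>I. c k + s k * d \<le> c i + s i * d"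
      by blast
    have "s i \<noteq> s j" using ij inj by (auto dest: inj_onD)
    then consider "s j < s i" | "s i < s j" by linarith
    then show ?thesis
    proof cases
      case 1
      with ij show ?thesis by blast
    next
      case 2
      with ij show ?thesis by (intro bexI[of _ j] bexI[of _ i]) auto
    qed
  qed
  then obtain f where f: "\<And>d. d \<in> D \<Longrightarrow> f d \<in> I \<and> (\<exists>j\<in>I. s j < s (f d)
      \<and> c (f d) + s (f d) * d = c j + s j * d \<and> (\<forall>k\<in>I. c k + s k * d \<le> c (f d) + s (f d) * d))"
    by metis
  have "Min (s ` I) \<in> s ` I" using fin ne by simp
  then obtain i0 where i0: "i0 \<in> I" "s i0 = Min (s ` I)" by fastforce
  have no_less: "s i0 \<le> s j" if "j \<in> I" for j using that i0 fin by simp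
  have sub: "f ` D \<subseteq> I - {i0}" using f no_less by fastforce
  \<comment> \<open>A tie at \<open>b\<close> with a line of smaller slope makes that line strictly larger to the left of \<open>b\<close>.\<close>
  have ne: "f a \<noteq> f b" if ab: "a \<in> D" "b \<in> D" "a < b" for a b
  proof
    assume eq: "f a = f b"
    from f[OF ab(2)] obtain j where j: "j \<in> I" "s j < s (f b)"
      "c (f b) + s (f b) * b = c j + s j * b" by blast
    from f[OF ab(1)] j(1) have "c j + s j * a \<le> c (f b) + s (f b) * a" using eq by auto
    moreover have "(s (f b) - s j) * a < (s (f b) - s j) * b" using j(2) ab(3) by simp
    ultimately show False using j(3) by (simp add: algebra_simps)
  qed
  have "inj_on f D" by (rule inj_onI, rule ccontr) (metis ne linorder_neq_iff)
  moreover have "card (I - {i0}) = card I - 1" using i0 fin by simp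
  ultimately show ?thesis
    using sub fin by (metis card_inj_on_le finite_Diff inj_on_finite)
qed

text \<open>If a single summand attained the maximal degree, its leading coefficient would survive
  in the sum.\<close>

lemma sum_poly_eq_0_max_degree_twice:
  fixes f :: "'i \<Rightarrow> 'a::comm_monoid_add poly"
  assumes fin: "finite I" and ne: "I \<noteq> {}" and nz: "\<And>i. i \<in> I \<Longrightarrow> f i \<noteq> 0"
    and sum: "(\<Sum>i\<in>I. f i) = 0"
  shows "\<exists>i\<in>I. \<exists>j\<in>I. i \<noteq> j \<and> degree (f i) = degree (f j) \<and> (\<forall>k\<in>I. degree (f k) \<le> degree (f i))"
proof -
  let ?g = "\<lambda>i. degree (f i)"
  have "Max (?g ` I) \<in> ?g ` I" using fin ne by simp
  then obtain i where i: "i \<in> I" "?g i = Max (?g ` I)" by fastforce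
  have le: "?g k \<le> ?g i" if "k \<in> I" for k using that i fin by simp
  have "\<exists>j\<in>I. i \<noteq> j \<and> ?g i = ?g j"
  proof (rule ccontr)
    assume "\<not> ?thesis"
    then have "coeff (f k) (?g i) = 0" if "k \<in> I - {i}" for k
      using that le[of k] by (auto intro!: coeff_eq_0 order.not_eq_order_implies_strict)
    then have "coeff (\<Sum>k\<in>I. f k) (?g i) = coeff (f i) (?g i)"
      by (simp add: coeff_sum sum.remove[OF fin i(1)])
    with sum nz[OF i(1)] show False by simp
  qed
  with i le show ?thesis by blast
qed

lemma to_fract_power: "to_fract (x ^ n) = to_fract x ^ n"
  by (induction n) auto

lemma rat_deriv_inverse:
  assumes "p \<noteq> 0"
  shows "rat_deriv (1 / to_fract p) = - to_fract (pderiv p) / to_fract p ^ 2"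
proof -
  have "1 / to_fract p = Fraction_Field.Fract 1 p"
    by (simp add: to_fract_def One_fract_def)
  then show ?thesis
    using rat_deriv_Fract[OF assms, of 1] by (simp add: Fract_conv_to_fract to_fract_power)
qed

text \<open>Multiplying by \<open>p ^ M\<close> clears all denominators, since \<open>M\<close>
  bounds both 2, the exponent in \<open>(1 / p)' = - p' / p ^ 2\<close>, and every \<open>n\<close>
  in \<open>N\<close>.\<close>

lemma denominator_equation:
  fixes A :: "nat \<Rightarrow> 'a::field poly"
  assumes N: "\<And>n. n \<in> N \<Longrightarrow> n \<le> M" and M: "2 \<le> M" and p: "p \<noteq> 0"
    and eq: "rat_deriv (1 / to_fract p) = (\<Sum>n\<in>N. to_fract (A n) * (1 / to_fract p) ^ n)"
  shows "pderiv p * p ^ (M - 2) + (\<Sum>n\<in>N. A n * p ^ (M - n)) = 0"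
proof -
  let ?P = "to_fract p"
  have P: "?P \<noteq> 0" using p by simp
  have pow: "?P ^ M * (1 / ?P) ^ n = ?P ^ (M - n)" if "n \<le> M" for n
    using that P by (simp add: power_diff power_one_over)
  have "- (to_fract (pderiv p) * ?P ^ (M - 2)) = ?P ^ M * rat_deriv (1 / ?P)"
    by (simp add: rat_deriv_inverse[OF p] power_one_over flip: pow[OF M])
  also have "\<dots> = (\<Sum>n\<in>N. to_fract (A n) * (?P ^ M * (1 / ?P) ^ n))"
    unfolding eq by (simp add: sum_distrib_left mult_ac)
  also have "\<dots> = (\<Sum>n\<in>N. to_fract (A n) * ?P ^ (M - n))"
    by (intro sum.cong) (simp_all only: pow N)
  finally have "to_fract (pderiv p * p ^ (M - 2) + (\<Sum>n\<in>N. A n * p ^ (M - n))) = 0"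
    by (simp add: to_fract_power add_eq_0_iff)
  then show ?thesis by (simp only: to_fract_eq_0_iff)
qed

text \<open>The cleared equation has \<open>card N + 1\<close> terms. The derivative term takes the
  index 1, which is free because \<open>N\<close> lies above 1; the slope is then
  \<open>M - n\<close> for every index, hence injective.\<close>

lemma card_denominator_degrees_le:
  fixes A :: "nat \<Rightarrow> 'a::field_char_0 poly"
  assumes fin: "finite N" and N: "\<And>n. n \<in> N \<Longrightarrow> 1 < n" and A: "\<And>n. n \<in> N \<Longrightarrow> A n \<noteq> 0"
    and S: "\<And>x. x \<in> S \<Longrightarrow> rat_deriv x = (\<Sum>n\<in>N. to_fract (A n) * x ^ n)"
    and nonconst: "\<And>x c. x \<in> S \<Longrightarrow> x \<noteq> to_fract [:c:]"
  shows "finite (denominator_degrees S) \<and> card (denominator_degrees S) \<le> card N"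
proof -
  \<comment> \<open>Inserting 2 keeps the subtraction in \<open>M - 2\<close> exact and the maximum
    defined even for empty \<open>N\<close>.\<close>
  define M where "M = Max (insert 2 N)"
  have M: "2 \<le> M" and NM: "\<And>n. n \<in> N \<Longrightarrow> n \<le> M"
    using fin by (auto simp: M_def)
  define I where "I = insert 1 N"
  have I: "finite I" "I \<noteq> {}" "card I = Suc (card N)"
    using fin N by (auto simp: I_def card_insert_if)
  \<comment> \<open>The index \<open>1\<close> stands for the term \<open>p' * p ^ (M - 2)\<close>, of degree \<open>(M - 1) * degree p - 1\<close>.\<close>
  define c where "c n = (if n = 1 then - 1 else int (degree (A n)))" for n
  define s where "s n = int M - int n" for n
  have "\<exists>i\<in>I. \<exists>j\<in>I. i \<noteq> j \<and> c i + s i * d = c j + s j * d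
      \<and> (\<forall>k\<in>I. c k + s k * d \<le> c i + s i * d)"
    if "d \<in> int ` denominator_degrees S" for d
  proof -
    from that obtain p where d: "d = int (degree p)" and pS: "1 / to_fract p \<in> S"
      by (auto simp: denominator_degrees_def)
    have deg: "degree p \<noteq> 0"
    proof
      assume "degree p = 0"
      then obtain a where "p = [:a:]" by (metis degree_eq_zeroE)
      \<comment> \<open>The case \<open>a = 0\<close> is covered by the convention
        \<open>1 / 0 = 0\<close> on both sides.\<close>
      then have "1 / to_fract p = to_fract [:1 / a:]"
        by (cases "a = 0") (auto simp: to_fract_def One_fract_def eq_fract one_pCons)
      with nonconst[OF pS] show False by blast
    qed
    \<comment> \<open>In characteristic zero only constants have derivative zero.\<close>
    then have p: "p \<noteq> 0" and p': "pderiv p \<noteq> 0" by (auto simp: pderiv_eq_0_iff)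
    define f where "f n = (if n = 1 then pderiv p * p ^ (M - 2) else A n * p ^ (M - n))" for n
    have nz: "f n \<noteq> 0" if "n \<in> I" for n
      using that A p p' by (auto simp: f_def I_def)
    have "pderiv p * p ^ (M - 2) + (\<Sum>n\<in>N. A n * p ^ (M - n)) = 0"
      by (rule denominator_equation[OF NM M p S[OF pS]])
    moreover have "(\<Sum>n\<in>N. f n) = (\<Sum>n\<in>N. A n * p ^ (M - n))"
      using N by (intro sum.cong) (auto simp: f_def)
    moreover have "1 \<notin> N" using N by blast
    ultimately have sum: "(\<Sum>n\<in>I. f n) = 0"
      using fin by (simp add: I_def f_def)
    have degf: "int (degree (f n)) = c n + s n * d" if "n \<in> I" for n
    proof (cases "n = 1")
      case True
      have "degree (f n) = degree p - 1 + (M - 2) * degree p"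
        using True p p' by (simp add: f_def degree_mult_eq degree_power_eq degree_pderiv)
      \<comment> \<open>Truncated subtraction does no harm here, as \<open>degree p\<close> is at
        least 1 and \<open>M\<close> at least 2.\<close>
      then have "int (degree (f n)) = int (degree p) - 1 + (int M - 2) * int (degree p)"
        using deg M by (simp add: of_nat_diff)
      then show ?thesis using True by (simp add: c_def s_def d algebra_simps)
    next
      case False
      then have n: "n \<in> N" using that by (simp add: I_def)
      have "degree (f n) = degree (A n) + (M - n) * degree p"
        using False p A[OF n] by (simp add: f_def degree_mult_eq degree_power_eq)
      then show ?thesis using False NM[OF n] by (simp add: c_def s_def d)
    qed
    obtain i j where ij: "i \<in> I" "j \<in> I" "i \<noteq> j" "degree (f i) = degree (f j)"
        "\<forall>k\<in>I. degree (f k) \<le> degree (f i)"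
      using sum_poly_eq_0_max_degree_twice[OF I(1,2) nz sum] by blast
    show ?thesis
      by (intro bexI[of _ i] bexI[of _ j]) (use ij in \<open>simp_all flip: degf\<close>)
  qed
  moreover have "inj_on s I" by (auto simp: inj_on_def s_def)
  ultimately have "finite (int ` denominator_degrees S)
      \<and> card (int ` denominator_degrees S) \<le> card I - 1"
    by (intro card_envelope_breakpoints[OF I(1,2)])
  then show ?thesis using I(3) by (simp add: finite_image_iff card_image)
qed

text \<open>Working over any field of characteristic zero lets one proof serve both
  \<open>real\<close> and \<open>complex\<close>.\<close>

lemma card_denominator_degrees_trinomial_le:
  fixes A1 A2 A3 :: "'a::field_char_0 poly"
  assumes n: "1 < n1" "n1 < n2" "n2 < n3" and A: "A1 \<noteq> 0" "A2 \<noteq> 0" "A3 \<noteq> 0"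
  defines "S \<equiv> nonconst_rat_solutions n1 n2 n3 A1 A2 A3"
  shows "finite (denominator_degrees S) \<and> card (denominator_degrees S) \<le> 3"
proof -
  define A where "A n = (if n = n1 then A1 else if n = n2 then A2 else A3)" for n
  have "finite (denominator_degrees S) \<and> card (denominator_degrees S) \<le> card {n1, n2, n3}"
  proof (rule card_denominator_degrees_le[where A = A])
    show "rat_deriv x = (\<Sum>n\<in>{n1, n2, n3}. to_fract (A n) * x ^ n)" if "x \<in> S" for x
      using that n by (simp add: S_def nonconst_rat_solutions_def A_def)
  qed (use n A in \<open>auto simp: A_def S_def nonconst_rat_solutions_def\<close>)
  with n show ?thesis by simp
qed

text \<open>Finiteness is claimed along with the bound because \<open>card\<close> of an infinite
  set is 0.\<close>

theorem corollary5p13: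
  fixes n1 n2 n3 :: nat
  assumes "1 < n1" and "n1 < n2" and "n2 < n3"
  shows "(\<forall>A1 A2 A3 :: real poly.
            A1 \<noteq> 0 \<and> A2 \<noteq> 0 \<and> A3 \<noteq> 0
            \<and> (\<exists>X \<subseteq> nonconst_rat_solutions n1 n2 n3 A1 A2 A3. card X = 3)
            \<longrightarrow> finite (denominator_degrees (nonconst_rat_solutions n1 n2 n3 A1 A2 A3))
              \<and> card (denominator_degrees (nonconst_rat_solutions n1 n2 n3 A1 A2 A3)) \<le> 3)
       \<and> (\<forall>A1 A2 A3 :: complex poly.
            A1 \<noteq> 0 \<and> A2 \<noteq> 0 \<and> A3 \<noteq> 0
            \<and> (\<exists>X \<subseteq> nonconst_rat_solutions n1 n2 n3 A1 A2 A3. card X = 3)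
            \<longrightarrow> finite (denominator_degrees (nonconst_rat_solutions n1 n2 n3 A1 A2 A3))
              \<and> card (denominator_degrees (nonconst_rat_solutions n1 n2 n3 A1 A2 A3)) \<le> 3)"
  by (rule conjI; intro allI impI; elim conjE; rule card_denominator_degrees_trinomial_le[OF assms])

end
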